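(* Let $A\in\mathrm{Sp}(2n)$ be a truly hyperbolic symplectic matrix, i.e. no eigenvalue of $A$ lies on the unit circle. Then the projection $\pi:\mathrm{Sp}(2n)\to\mathcal{C}onj(\mathrm{Sp}(2n))$ maps the positive cone $\mathcal{P}_A$ at $A$ onto the tangent space to $\mathcal{C}onj(\mathrm{Sp}(2n))$ at $\pi(A)$.
   Context: $J=\mathrm{diag}(J_2,\dots,J_2)$ with $J_2=\begin{pmatrix}0&-1\\1&0\end{pmatrix}$, $\mathrm{Sp}(2n)=\{M\in\mathrm{GL}(2n,\mathbf{R}):M^TJM=J\}$. $\pi(A)=\{XAX^{-1}:X\in\mathrm{Sp}(2n)\}$ is the conjugacy class of $A$ in $\mathrm{Sp}(2n)$ and $\mathcal{C}onj(\mathrm{Sp}(2n))$ is the set of conjugacy classes. The positive cone is $\mathcal{P}_A=\{JPA: P=P^T,\ P>0\}\subset T_A\mathrm{Sp}(2n)=\{JQA:Q=Q^T\}$. The tangent space to $\mathcal{C}onj(\mathrm{Sp}(2n))$ at $\pi(A)$ is understood as the quotient of $T_A\mathrm{Sp}(2n)$ by the tangent space at $A$ of the conjugacy class of $A$; thus surjectivity means: for every symmetric $Q$ there is a symmetric positive definite $P$ such that $JPA-JQA$ is tangent at $A$ to the conjugacy class of $A$. *)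

theory Defs
  imports "HOL-Analysis.Analysis"
begin

text \<open>The standard symplectic space of dimension \<open>2n\<close> has coordinates indexed by \<open>'n \<times> 2\<close>, where
  \<open>n = CARD('n)\<close>; the index \<open>(i, a)\<close> is coordinate \<open>a\<close> of the \<open>i\<close>-th diagonal block.\<close>

type_synonym 'n sp_mat = "real ^ ('n \<times> 2) ^ ('n \<times> 2)"

definition J2 :: "real ^ 2 ^ 2" where
  "J2 = vector [vector [0, -1], vector [1, 0]]"

definition J :: "('n::finite) sp_mat" where
  "J = (\<chi> p q. if fst p = fst q then J2 $ snd p $ snd q else 0)"

definition Sp :: "('n::finite) sp_mat set" where
  "Sp = {M. invertible M \<and> transpose M ** J ** M = J}"

definition conj_class :: "('n::finite) sp_mat \<Rightarrow> 'n sp_mat set" where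
  "conj_class A = {X ** A ** matrix_inv X | X. X \<in> Sp}"

definition eigenvalue :: "real ^ 'm ^ 'm \<Rightarrow> complex \<Rightarrow> bool" where
  "eigenvalue A z \<longleftrightarrow> (\<exists>v. v \<noteq> 0 \<and> map_matrix complex_of_real A *v v = z *s v)"

definition truly_hyperbolic :: "real ^ 'm ^ 'm \<Rightarrow> bool" where
  "truly_hyperbolic A \<longleftrightarrow> (\<forall>z. eigenvalue A z \<longrightarrow> norm z \<noteq> 1)"

definition positive_definite :: "real ^ 'm ^ 'm \<Rightarrow> bool" where
  "positive_definite P \<longleftrightarrow> (\<forall>x. x \<noteq> 0 \<longrightarrow> x \<bullet> (P *v x) > 0)"

definition positive_cone :: "('n::finite) sp_mat \<Rightarrow> 'n sp_mat set" where
  "positive_cone A = {J ** P ** A | P. transpose P = P \<and> positive_definite P}"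

definition tangent_Sp :: "('n::finite) sp_mat \<Rightarrow> 'n sp_mat set" where
  "tangent_Sp A = {J ** Q ** A | Q. transpose Q = Q}"

text \<open>Tangent vectors to a subset \<open>S\<close> at \<open>p\<close>: velocities of \<open>C\<^sup>1\<close> curves through \<open>p\<close> inside \<open>S\<close>.
  For an embedded submanifold this is the usual tangent space. Conjugacy classes in the symplectic
  group are of this kind, being orbits of an algebraic action.\<close>

definition tangent_vectors :: "'a::real_normed_vector set \<Rightarrow> 'a \<Rightarrow> 'a set" where
  "tangent_vectors S p = {v. \<exists>c e. e > 0 \<and> c C1_differentiable_on {-e<..<e} \<and>
     c ` {-e<..<e} \<subseteq> S \<and> c 0 = p \<and> (c has_vector_derivative v) (at 0)}"

text \<open>The tangent space to the set of conjugacy classes at the class of \<open>A\<close> is the quotient of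
  \<open>tangent_Sp A\<close> by \<open>tangent_vectors (conj_class A) A\<close>. A set \<open>C\<close> of tangent vectors maps onto it
  iff every \<open>V\<close> in \<open>tangent_Sp A\<close> is congruent to some element of \<open>C\<close>.\<close>

definition maps_onto_tangent_Conj :: "('n::finite) sp_mat set \<Rightarrow> 'n sp_mat \<Rightarrow> bool" where
  "maps_onto_tangent_Conj C A \<longleftrightarrow> C \<subseteq> tangent_Sp A \<and>
     (\<forall>V \<in> tangent_Sp A. \<exists>W \<in> C. W - V \<in> tangent_vectors (conj_class A) A)"

end

theory Submission
  imports Defs "HOL-Computational_Algebra.Fundamental_Theorem_Algebra"
begin

text \<open>The infinitesimal conjugation of \<open>A\<close> by \<open>J Y\<close>, with \<open>Y\<close> symmetric, is the vector \<open>J Y A - A J Y\<close>, which is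
  tangent to the conjugacy class of \<open>A\<close>. Symplecticity gives \<open>A J A\<^sup>T = J\<close>, so for \<open>Y = - A\<^sup>T Z A\<close> the vector
  is \<open>J (Z - A\<^sup>T Z A) A\<close>. Hence it is enough to find, for each symmetric \<open>Q\<close>, a symmetric \<open>Z\<close>
  for which \<open>P = Q + Z - A\<^sup>T Z A\<close> is positive definite.

  Such a \<open>Z\<close> exists for every hyperbolic invertible \<open>A\<close>. One could take the stable and unstable subspaces of
  \<open>A\<close> and sum a geometric series on each; the argument below is the dual one
  (\<open>stein_inequality\<close>). If no \<open>Z\<close> exists, a separating hyperplane yields a nonzero
  positive semidefinite symmetric \<open>S\<close> with \<open>A S A\<^sup>T = S\<close>. Then \<open>A\<close> acts on the range of \<open>S\<close> as an isometry
  of an inner product and so has an eigenvalue of modulus one there, against hyperbolicity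
  (\<open>invariant_psd_form_eq_0\<close>).

  For tangency one needs an actual \<open>C\<^sup>1\<close> curve of symplectic matrices with velocity \<open>J Y\<close> at the
  identity. Every symmetric \<open>Y\<close> is a combination of squares \<open>y y\<^sup>T\<close>, for which the transvections
  \<open>I + t J y y\<^sup>T\<close> form a one-parameter group; their product is a polynomial curve with
  polynomial inverse (\<open>symplectic_velocity_symmetric\<close>).\<close>

section \<open>Calculus of square matrices\<close>

text \<open>Provides the rules for sums, signs and scalars in a product of square matrices, and the
  Leibniz rule and continuity of such products.\<close>

interpretation matrix_mult: bounded_bilinear
  "(**) :: real ^ 'm ^ 'm \<Rightarrow> real ^ 'm ^ 'm \<Rightarrow> real ^ 'm ^ 'm"
proof -
  have "(L + M) ** N = L ** N + M ** N" for L M N :: "real ^ 'm ^ 'm"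
    by (simp add: matrix_matrix_mult_def vec_eq_iff distrib_right sum.distrib)
  then have "bilinear ((**) :: real ^ 'm ^ 'm \<Rightarrow> real ^ 'm ^ 'm \<Rightarrow> real ^ 'm ^ 'm)"
    unfolding bilinear_def
    by (auto intro!: linearI simp: matrix_add_ldistrib matrix_scalar_ac scalar_matrix_assoc)
  then show "bounded_bilinear ((**) :: real ^ 'm ^ 'm \<Rightarrow> real ^ 'm ^ 'm \<Rightarrow> real ^ 'm ^ 'm)"
    by (simp add: bilinear_conv_bounded_bilinear)
qed

lemma transpose_add: "transpose (M + N) = transpose M + transpose (N :: 'a::ab_semigroup_add ^ 'n ^ 'm)"
  by (simp add: transpose_def vec_eq_iff)

lemma C1_differentiable_on_matrix_mult:
  fixes X Y :: "real \<Rightarrow> real ^ 'm ^ 'm"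
  assumes "X C1_differentiable_on S" "Y C1_differentiable_on S"
  shows "(\<lambda>t. X t ** Y t) C1_differentiable_on S"
proof -
  obtain X' Y' where X: "\<And>t. t \<in> S \<Longrightarrow> (X has_vector_derivative X' t) (at t)" "continuous_on S X'"
    and Y: "\<And>t. t \<in> S \<Longrightarrow> (Y has_vector_derivative Y' t) (at t)" "continuous_on S Y'"
    using assms unfolding C1_differentiable_on_def by auto
  have "continuous_on S X" "continuous_on S Y"
    using X Y by (meson continuous_at_imp_continuous_on has_vector_derivative_continuous)+
  with X Y have "continuous_on S (\<lambda>t. X t ** Y' t + X' t ** Y t)"
    by (intro continuous_on_add matrix_mult.continuous_on)
  then show ?thesis
    unfolding C1_differentiable_on_def
    using matrix_mult.has_vector_derivative[OF X(1) Y(1)]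
    by (intro exI[of _ "\<lambda>t. X t ** Y' t + X' t ** Y t"]) simp
qed

lemma matrix_inv_eqI:
  fixes X :: "real ^ 'n ^ 'n"
  assumes "X ** Y = mat 1"
  shows "matrix_inv X = Y"
proof -
  have YX: "Y ** X = mat 1" using assms by (simp add: matrix_left_right_inverse)
  have "X ** matrix_inv X = mat 1 \<and> matrix_inv X ** X = mat 1"
    unfolding matrix_inv_def by (rule someI[of _ Y]) (simp add: assms YX)
  then show ?thesis by (metis YX matrix_mul_assoc matrix_mul_lid matrix_mul_rid)
qed

section \<open>Eigenvectors in invariant subspaces\<close>

text \<open>This is \<open>p(T) v\<close>, evaluated by Horner's scheme so that it recurses along the coefficient
  list of \<open>p\<close> without forming powers of \<open>T\<close>.\<close>

definition poly_act :: "'a::field ^ 'm ^ 'm \<Rightarrow> 'a poly \<Rightarrow> 'a ^ 'm \<Rightarrow> 'a ^ 'm" where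
  "poly_act T p v = fold_coeffs (\<lambda>c x. c *s v + T *v x) p 0"

lemma poly_act_0 [simp]: "poly_act T 0 v = 0"
  by (simp add: poly_act_def)

lemma poly_act_pCons [simp]: "poly_act T (pCons c p) v = c *s v + T *v poly_act T p v"
  by (cases "p = 0"; cases "c = 0") (simp_all add: poly_act_def)

lemma poly_act_add: "poly_act T (p + q) v = poly_act T p v + poly_act T q v"
proof (induction p arbitrary: q)
  case (pCons c p)
  show ?case
  proof (cases q)
    fix d q' assume "q = pCons d q'"
    then show ?thesis
      by (simp add: pCons.IH matrix_vector_right_distrib vec.scale_left_distrib)
  qed
qed simp

lemma poly_act_smult: "poly_act T (smult c p) v = c *s poly_act T p v"
  by (induction p)
    (simp_all add: vec.scale_right_distrib vector_scalar_commute vector_smult_assoc)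

lemma poly_act_sum: "poly_act T (\<Sum>i\<in>I. p i) v = (\<Sum>i\<in>I. poly_act T (p i) v)"
  by (induction I rule: infinite_finite_induct) (simp_all add: poly_act_add)

lemma poly_act_monom: "poly_act T (monom c i) v = c *s ((\<lambda>x. T *v x) ^^ i) v"
  by (induction i) (simp_all add: monom_0 monom_Suc vector_scalar_commute)

lemma poly_act_in_subspace:
  assumes "vec.subspace W" "\<And>x. x \<in> W \<Longrightarrow> T *v x \<in> W" "v \<in> W"
  shows "poly_act T p v \<in> W"
  by (induction p)
    (simp_all add: assms vec.subspace_0 vec.subspace_add vec.subspace_scale)

text \<open>The iterates of \<open>v\<close> under \<open>T\<close> are linearly dependent, since the space has finite
  dimension, and a dependence between them is a polynomial.\<close>

lemma annihilating_polynomial: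
  fixes T :: "'a::field ^ 'm ^ 'm"
  obtains p where "p \<noteq> 0" "poly_act T p v = 0"
proof -
  define f where "f i = ((\<lambda>x. T *v x) ^^ i) v" for i
  show thesis
  proof (cases "inj f")
    case False
    then obtain i j where "i \<noteq> j" "f i = f j" by (auto simp: inj_def)
    then have "poly_act T (monom 1 i + monom (-1) j) v = 0"
      by (simp add: poly_act_add poly_act_monom f_def)
    moreover have "coeff (monom 1 i + monom (-1::'a) j) i \<noteq> 0"
      using \<open>i \<noteq> j\<close> by simp
    then have "monom 1 i + monom (-1::'a) j \<noteq> 0" by (metis coeff_0)
    ultimately show ?thesis using that by blast
  next
    case True
    then have "infinite (range f)" by (rule range_inj_infinite)
    then have "vec.dependent (range f)"
      using vec.finiteI_independent by blast
    then obtain S u where S: "finite S" "S \<subseteq> range f" "(\<Sum>x\<in>S. u x *s x) = 0" "\<exists>x\<in>S. u x \<noteq> 0"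
      unfolding vec.dependent_explicit by blast
    then obtain I where I: "S = f ` I" "finite I"
      by (metis finite_subset_image)
    define p where "p = (\<Sum>i\<in>I. monom (u (f i)) i)"
    have "poly_act T p v = (\<Sum>i\<in>I. u (f i) *s f i)"
      by (simp add: p_def poly_act_sum poly_act_monom f_def)
    also have "\<dots> = 0"
      using S(3) True by (simp add: I sum.reindex inj_on_subset)
    finally have "poly_act T p v = 0" .
    moreover obtain k where k: "k \<in> I" "u (f k) \<noteq> 0" using S(4) I by auto
    have "coeff p k = u (f k)"
      using k I by (simp add: p_def coeff_sum)
    then have "p \<noteq> 0" using k by auto
    ultimately show ?thesis using that by blast
  qed
qed

text \<open>Splitting off one linear factor at a time from a polynomial \<open>p\<close> with \<open>p(T) v = 0\<close>,
  there is a first stage where the remaining factor \<open>q\<close> satisfies \<open>q(T) v \<noteq> 0\<close>; that vector is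
  killed by \<open>T - z\<close>, and it stays in the invariant subspace because it is a polynomial in \<open>T\<close>
  applied to \<open>v\<close>.\<close>

lemma eigenvector_in_invariant_subspace:
  fixes T :: "complex ^ 'm ^ 'm"
  assumes W: "vec.subspace W" "\<And>x. x \<in> W \<Longrightarrow> T *v x \<in> W"
    and v: "v \<in> W" "v \<noteq> 0"
  obtains z w where "w \<in> W" "w \<noteq> 0" "T *v w = z *s w"
proof -
  have "\<exists>z w. w \<in> W \<and> w \<noteq> 0 \<and> T *v w = z *s w" if "p \<noteq> 0" "poly_act T p v = 0" for p
    using that
  proof (induction "degree p" arbitrary: p rule: less_induct)
    case less
    show ?case
    proof (cases "degree p = 0")
      case True
      then obtain c where "p = [:c:]" by (rule degree_eq_zeroE)
      then show ?thesis using less.prems v by simp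
    next
      case False
      then obtain z where "poly p z = 0"
        using fundamental_theorem_of_algebra[of p] by (auto simp: constant_degree)
      then obtain q where q: "p = [:-z, 1:] * q" by (auto simp: poly_eq_0_iff_dvd)
      then have "q \<noteq> 0" using less.prems by auto
      then have deg: "degree q < degree p"
        using degree_mult_eq[of "[:-z, 1:]" q] by (simp add: q del: mult_pCons_left)
      have "p = pCons 0 q + smult (-z) q" by (simp add: q)
      then have "poly_act T p v = T *v poly_act T q v - z *s poly_act T q v"
        by (simp only: poly_act_add poly_act_smult poly_act_pCons) simp
      then have eig: "T *v poly_act T q v = z *s poly_act T q v" using less.prems by simp
      show ?thesis
      proof (cases "poly_act T q v = 0")
        case True
        then show ?thesis using less.hyps deg \<open>q \<noteq> 0\<close> by blast
      next
        case False
        then show ?thesis using eig poly_act_in_subspace[OF W v(1)] by blast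
      qed
    qed
  qed
  then show thesis using annihilating_polynomial[of T v] that by metis
qed

section \<open>Invariant semidefinite forms\<close>

definition complex_vec :: "real ^ 'm \<Rightarrow> real ^ 'm \<Rightarrow> complex ^ 'm" where
  "complex_vec a b = (\<chi> i. Complex (a $ i) (b $ i))"

lemma complex_vec_eq_iff: "complex_vec a b = complex_vec c d \<longleftrightarrow> a = c \<and> b = d"
  by (auto simp: complex_vec_def vec_eq_iff)

lemma complex_vec_0: "complex_vec 0 0 = 0"
  by (simp add: complex_vec_def vec_eq_iff complex_eq_iff)

lemma complex_vec_add: "complex_vec a b + complex_vec c d = complex_vec (a + c) (b + d)"
  by (simp add: complex_vec_def vec_eq_iff complex_eq_iff)

lemma complex_vec_scale:
  "z *s complex_vec a b
    = complex_vec (Re z *\<^sub>R a - Im z *\<^sub>R b) (Re z *\<^sub>R b + Im z *\<^sub>R a)"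
  by (simp add: complex_vec_def vec_eq_iff complex_eq_iff)

lemma complex_vec_matrix_mult:
  "map_matrix complex_of_real M *v complex_vec a b = complex_vec (M *v a) (M *v b)"
  by (simp add: complex_vec_def vec_eq_iff complex_eq_iff matrix_vector_mult_def)

lemma inner_symmetric_matrix:
  fixes S :: "real ^ 'm ^ 'm"
  assumes "transpose S = S"
  shows "x \<bullet> (S *v y) = (S *v x) \<bullet> y"
  by (metis assms dot_lmul_matrix transpose_matrix_vector)

text \<open>A null vector \<open>x\<close> of the form is a minimum of it, so its gradient \<open>2 S x\<close> vanishes there.
  Concretely, moving from \<open>x\<close> a little in the direction \<open>- S x\<close> would make the form negative.\<close>

lemma psd_kernel:
  fixes S :: "real ^ 'm ^ 'm"
  assumes sym: "transpose S = S" and psd: "\<And>x. 0 \<le> x \<bullet> (S *v x)"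
    and zero: "x \<bullet> (S *v x) = 0"
  shows "S *v x = 0"
proof (rule ccontr)
  assume nz: "S *v x \<noteq> 0"
  define y where "y = S *v x"
  define n where "n = y \<bullet> y"
  define k where "k = y \<bullet> (S *v y)"
  have "n > 0" "k \<ge> 0" using nz psd by (auto simp: n_def y_def k_def)
  have q: "(x + t *\<^sub>R y) \<bullet> (S *v (x + t *\<^sub>R y)) = 2 * t * n + t * t * k" for t
    using inner_symmetric_matrix[OF sym, of x y] zero
    by (simp add: algebra_simps inner_add_left inner_add_right n_def k_def y_def[symmetric])
  \<comment> \<open>The parabola \<open>2 t n + t\<^sup>2 k\<close> has its minimum at \<open>- n / k\<close>; \<open>k + 1\<close> avoids dividing by zero.\<close>
  define t where "t = - n / (k + 1)"
  have "2 * t * n + t * t * k = - (n * n) / (k + 1) * (2 - k / (k + 1))"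
    using \<open>k \<ge> 0\<close> by (simp add: t_def divide_simps) (simp add: algebra_simps)
  moreover have "2 - k / (k + 1) > 0" "- (n * n) / (k + 1) < 0"
    using \<open>n > 0\<close> \<open>k \<ge> 0\<close> by (auto simp: field_simps)
  ultimately have "2 * t * n + t * t * k < 0" by (metis mult_neg_pos)
  with psd[of "x + t *\<^sub>R y"] show False by (simp add: q)
qed

text \<open>On the range of \<open>S\<close>, which \<open>A\<close> maps to itself, \<open>S\<close> induces a positive definite inner
  product by \<open>\<langle>S x, S y\<rangle> = x\<^sup>T S y\<close>, and the invariance of \<open>S\<close> says that \<open>A\<close> is an isometry for it. If
  \<open>S \<noteq> 0\<close>, this isometry has a complex eigenvector, whose eigenvalue has modulus one. The proof
  works with preimages under \<open>S\<close>: with \<open>C = (A\<^sup>T)\<^sup>-\<^sup>1\<close>, the equation \<open>A S = S C\<close> carries the action of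
  \<open>A\<close> on the range over to that of \<open>C\<close>, which preserves the form of \<open>S\<close>.\<close>

lemma invariant_psd_form_eq_0:
  fixes A S :: "real ^ 'm ^ 'm"
  assumes hyp: "truly_hyperbolic A" and inv: "invertible A"
    and sym: "transpose S = S" and psd: "\<And>x. 0 \<le> x \<bullet> (S *v x)"
    and invar: "A ** S ** transpose A = S"
  shows "S = 0"
proof (rule ccontr)
  assume "S \<noteq> 0"
  obtain B where B: "A ** B = mat 1" "B ** A = mat 1" using inv by (auto simp: invertible_def)
  define C where "C = transpose B"
  have AC: "transpose A ** C = mat 1"
    by (simp add: C_def B matrix_transpose_mul[symmetric])
  have AS: "A ** S = S ** C"
    by (metis AC invar matrix_mul_assoc matrix_mul_rid)
  have ASv: "A *v (S *v x) = S *v (C *v x)" for x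
    by (simp add: matrix_vector_mul_assoc AS)
  have "transpose C ** S ** C = S"
    by (metis AS B(2) C_def matrix_mul_assoc matrix_mul_lid transpose_transpose)
  then have qC: "(C *v x) \<bullet> (S *v (C *v x)) = x \<bullet> (S *v x)" for x
    by (metis dot_lmul_matrix matrix_vector_mul_assoc transpose_matrix_vector transpose_transpose)
  define T where "T = map_matrix complex_of_real A"
  define W where "W = {complex_vec (S *v a) (S *v b) | a b. True}"
  have WI: "complex_vec (S *v a) (S *v b) \<in> W" for a b by (auto simp: W_def)
  have "vec.subspace W"
  proof (rule vec.subspaceI)
    show "0 \<in> W" using WI[of 0 0] by (simp add: complex_vec_0)
  next
    fix x y assume "x \<in> W" "y \<in> W"
    then obtain a b c d where "x = complex_vec (S *v a) (S *v b)" "y = complex_vec (S *v c) (S *v d)"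
      by (auto simp: W_def)
    then have "x + y = complex_vec (S *v (a + c)) (S *v (b + d))"
      by (simp add: complex_vec_add matrix_vector_right_distrib)
    then show "x + y \<in> W" by (simp add: WI)
  next
    fix c x assume "x \<in> W"
    then obtain a b where "x = complex_vec (S *v a) (S *v b)" by (auto simp: W_def)
    then have "c *s x = complex_vec (S *v (Re c *\<^sub>R a - Im c *\<^sub>R b)) (S *v (Re c *\<^sub>R b + Im c *\<^sub>R a))"
      by (simp add: complex_vec_scale algebra_simps)
    then show "c *s x \<in> W" by (simp add: WI)
  qed
  moreover have "T *v x \<in> W" if x: "x \<in> W" for x
  proof -
    obtain a b where "x = complex_vec (S *v a) (S *v b)" using x by (auto simp: W_def)
    then show ?thesis by (simp add: T_def complex_vec_matrix_mult ASv WI)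
  qed
  moreover obtain a where "S *v a \<noteq> 0"
    using \<open>S \<noteq> 0\<close> by (metis matrix_eq matrix_vector_mult_0)
  then have "complex_vec (S *v a) (S *v 0) \<noteq> 0" "complex_vec (S *v a) (S *v 0) \<in> W"
    using WI[of a 0] by (simp_all add: complex_vec_0[symmetric] complex_vec_eq_iff)
  ultimately obtain z w where w: "w \<in> W" "w \<noteq> 0" "T *v w = z *s w"
    using eigenvector_in_invariant_subspace by metis
  then obtain a b where ab: "w = complex_vec (S *v a) (S *v b)" by (auto simp: W_def)
  \<comment> \<open>For \<open>u = a + i b\<close>, the vectors \<open>p\<close> and \<open>r\<close> are the real and imaginary part of \<open>z u\<close>.\<close>
  define p where "p = Re z *\<^sub>R a - Im z *\<^sub>R b"
  define r where "r = Re z *\<^sub>R b + Im z *\<^sub>R a"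
  have Ca: "S *v (C *v a) = S *v p" and Cb: "S *v (C *v b) = S *v r"
    using w(3) by (simp_all add: ab T_def complex_vec_matrix_mult complex_vec_scale
        complex_vec_eq_iff ASv p_def r_def algebra_simps)
  define q where "q x = x \<bullet> (S *v x)" for x
  have "q a = q p"
    using qC[of a] inner_symmetric_matrix[OF sym, of "C *v a" p]
    by (simp add: Ca q_def inner_commute)
  moreover have "q b = q r"
    using qC[of b] inner_symmetric_matrix[OF sym, of "C *v b" r]
    by (simp add: Cb q_def inner_commute)
  moreover have "q p + q r = ((Re z)\<^sup>2 + (Im z)\<^sup>2) * (q a + q b)"
    by (simp add: q_def p_def r_def algebra_simps inner_add_left inner_add_right
        inner_diff_left inner_diff_right power2_eq_square)
  moreover have "q a + q b > 0"
  proof -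
    have "q a \<ge> 0" "q b \<ge> 0" using psd by (auto simp: q_def)
    moreover have "q a \<noteq> 0 \<or> q b \<noteq> 0"
      using w(2) psd_kernel[OF sym psd] unfolding q_def ab by (metis complex_vec_0)
    ultimately show ?thesis by linarith
  qed
  ultimately have "(Re z)\<^sup>2 + (Im z)\<^sup>2 = 1" by simp
  then have "norm z = 1" by (simp add: norm_complex_def)
  moreover have "eigenvalue A z" using w by (auto simp: eigenvalue_def T_def)
  ultimately show False using hyp by (simp add: truly_hyperbolic_def)
qed

section \<open>Solving the Stein inequality by duality\<close>

lemma inner_matrix_mult_left:
  fixes M N P :: "real ^ 'm ^ 'm"
  shows "P \<bullet> (M ** N) = (transpose M ** P) \<bullet> N"
proof -
  have "P \<bullet> (M ** N) = (\<Sum>i\<in>UNIV. \<Sum>j\<in>UNIV. \<Sum>k\<in>UNIV. M$i$k * P$i$j * N$k$j)"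
    by (simp add: inner_vec_def matrix_matrix_mult_def sum_distrib_left mult_ac)
  also have "\<dots> = (\<Sum>k\<in>UNIV. \<Sum>j\<in>UNIV. \<Sum>i\<in>UNIV. M$i$k * P$i$j * N$k$j)"
    by (subst sum.swap, subst sum.swap, subst (2) sum.swap) rule
  also have "\<dots> = (transpose M ** P) \<bullet> N"
    by (simp add: inner_vec_def matrix_matrix_mult_def transpose_def sum_distrib_right)
  finally show ?thesis .
qed

lemma inner_transpose: "transpose M \<bullet> transpose N = M \<bullet> (N :: real ^ 'm ^ 'm)"
  unfolding inner_vec_def transpose_def by (simp, rule sum.swap)

lemma inner_matrix_mult_right:
  fixes M N P :: "real ^ 'm ^ 'm"
  shows "P \<bullet> (M ** N) = (P ** transpose N) \<bullet> M"
  using inner_matrix_mult_left[of "transpose P" "transpose N" "transpose M"]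
  by (metis inner_transpose matrix_transpose_mul transpose_transpose)

definition outer_prod :: "real ^ 'm \<Rightarrow> real ^ 'm \<Rightarrow> real ^ 'm ^ 'm" where
  "outer_prod x y = (\<chi> i j. x $ i * y $ j)"

lemma outer_prod_mult_vec: "outer_prod x y *v z = (y \<bullet> z) *\<^sub>R x"
  by (simp add: outer_prod_def matrix_vector_mult_def vec_eq_iff inner_vec_def sum_distrib_left mult_ac)

lemma inner_outer_prod: "S \<bullet> outer_prod x y = x \<bullet> (S *v y)"
  by (simp add: outer_prod_def matrix_vector_mult_def inner_vec_def sum_distrib_left mult_ac)

text \<open>The cone of positive semidefinite matrices is self-dual: testing against \<open>x x\<^sup>T\<close> gives
  \<open>x\<^sup>T S x \<ge> 0\<close>. No symmetry is built into \<^const>\<open>positive_definite\<close>, so skew matrices may be added to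
  test matrices freely, and testing against \<open>\<plusminus>(x y\<^sup>T - y x\<^sup>T)\<close> forces \<open>S\<close> to be symmetric.\<close>

lemma psd_of_dual:
  fixes S :: "real ^ 'm ^ 'm"
  assumes nonneg: "\<And>M. positive_definite M \<Longrightarrow> 0 \<le> S \<bullet> M"
  shows "transpose S = S" "0 \<le> x \<bullet> (S *v x)"
proof -
  \<comment> \<open>A semidefinite \<open>N\<close> is reached by the definite matrices \<open>I + t N\<close> for large \<open>t\<close>, up to scaling.\<close>
  have psd: "0 \<le> S \<bullet> N" if N: "\<And>x. 0 \<le> x \<bullet> (N *v x)" for N
  proof (rule ccontr)
    assume neg: "\<not> 0 \<le> S \<bullet> N"
    define t where "t = (\<bar>S \<bullet> mat 1\<bar> + 1) / - (S \<bullet> N)"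
    have "t > 0" using neg unfolding t_def by (intro divide_pos_pos) linarith+
    then have "positive_definite (mat 1 + t *\<^sub>R N)"
      using N by (auto simp: positive_definite_def matrix_vector_mult_add_rdistrib
          scaleR_matrix_vector_assoc[symmetric] inner_add_right intro!: add_pos_nonneg)
    from nonneg[OF this] have "0 \<le> S \<bullet> mat 1 + t * (S \<bullet> N)"
      by (simp add: inner_add_right)
    moreover have "t * (S \<bullet> N) = - (\<bar>S \<bullet> mat 1\<bar> + 1)" using neg by (simp add: t_def)
    ultimately show False by linarith
  qed
  show "0 \<le> x \<bullet> (S *v x)"
    using psd[of "outer_prod x x"]
    by (simp add: inner_outer_prod outer_prod_mult_vec inner_commute)
  have le: "y \<bullet> (S *v x) \<le> x \<bullet> (S *v y)" for x y
    using psd[of "outer_prod x y - outer_prod y x"]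
    by (simp add: inner_outer_prod outer_prod_mult_vec matrix_vector_mult_diff_rdistrib
        inner_diff_right inner_commute)
  then have "y \<bullet> (transpose S *v x) = y \<bullet> (S *v x)" for x y
    by (metis antisym dot_lmul_matrix inner_commute transpose_matrix_vector)
  then show "transpose S = S" by (metis matrix_eq vector_eq_ldot)
qed

text \<open>If the affine space of all \<open>Q + Z - A\<^sup>T Z A\<close> missed the convex cone of positive
  definite matrices, a hyperplane \<open>S\<close> would separate them. Being bounded above on the affine
  space, \<open>S\<close> annihilates every \<open>Z - A\<^sup>T Z A\<close>, which in terms of the trace pairing is
  \<open>A S A\<^sup>T = S\<close>; being bounded below on a cone, it is nonnegative there, hence positive semidefinite.
  Hyperbolicity excludes such an \<open>S\<close>.\<close>

lemma stein_inequality: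
  fixes A Q :: "real ^ 'm ^ 'm"
  assumes hyp: "truly_hyperbolic A" and inv: "invertible A"
  obtains Z where "positive_definite (Q + (Z - transpose A ** Z ** A))"
proof (rule ccontr)
  assume "\<not> thesis"
  then have none: "\<not> positive_definite (Q + (Z - transpose A ** Z ** A))" for Z
    using that by blast
  define L where "L = range (\<lambda>Z. Z - transpose A ** Z ** A)"
  define PD where "PD = {M :: real ^ 'm ^ 'm. positive_definite M}"
  have "linear (\<lambda>Z. Z - transpose A ** Z ** A)"
    by (rule linearI)
      (simp_all add: matrix_mult.add_right matrix_mult.add_left matrix_mult.scaleR_right
        matrix_mult.scaleR_left algebra_simps)
  then have L: "subspace L" unfolding L_def by (intro linear_subspace_image subspace_UNIV)
  have scale: "t *\<^sub>R M \<in> PD" if "M \<in> PD" "t > 0" for M t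
    using that by (auto simp: PD_def positive_definite_def scaleR_matrix_vector_assoc[symmetric])
  have add: "M + N \<in> PD" if "M \<in> PD" "N \<in> PD" for M N
    using that by (auto simp: PD_def positive_definite_def matrix_vector_mult_add_rdistrib
        inner_add_right add_pos_pos)
  have "convex PD"
  proof (rule convexI)
    fix M N :: "real ^ 'm ^ 'm" and u v :: real
    assume *: "M \<in> PD" "N \<in> PD" "0 \<le> u" "0 \<le> v" "u + v = 1"
    consider "u = 0" "v = 1" | "v = 0" "u = 1" | "u > 0" "v > 0" using * by fastforce
    then show "u *\<^sub>R M + v *\<^sub>R N \<in> PD" by cases (use * scale add in auto)
  qed
  moreover have "convex ((+) Q ` L)"
    using L by (intro convex_translation subspace_imp_convex)
  moreover have one: "mat 1 \<in> PD" by (simp add: PD_def positive_definite_def)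
  moreover have "(+) Q ` L \<inter> PD = {}" using none by (auto simp: L_def PD_def)
  moreover have "(+) Q ` L \<noteq> {}" "PD \<noteq> {}" using one by (auto simp: L_def)
  ultimately obtain S b where S: "S \<noteq> 0" and below: "\<And>M. M \<in> (+) Q ` L \<Longrightarrow> S \<bullet> M \<le> b"
    and above: "\<And>M. M \<in> PD \<Longrightarrow> b \<le> S \<bullet> M"
    by (metis separating_hyperplane_sets)
  have orth: "S \<bullet> l = 0" if "l \<in> L" for l
  proof (rule ccontr)
    assume nz: "S \<bullet> l \<noteq> 0"
    define t where "t = (b - S \<bullet> Q + 1) / (S \<bullet> l)"
    have "t *\<^sub>R l \<in> L" using L that by (simp add: subspace_scale)
    then have "S \<bullet> (Q + t *\<^sub>R l) \<le> b" using below by blast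
    then show False using nz by (simp add: inner_add_right t_def)
  qed
  have "0 \<le> S \<bullet> M" if M: "positive_definite M" for M
  proof (rule ccontr)
    assume neg: "\<not> 0 \<le> S \<bullet> M"
    define t where "t = (\<bar>b\<bar> + 1) / - (S \<bullet> M)"
    have "t > 0" using neg unfolding t_def by (intro divide_pos_pos) linarith+
    then have "b \<le> S \<bullet> (t *\<^sub>R M)" using M by (intro above scale) (simp_all add: PD_def)
    moreover have "t * (S \<bullet> M) = - (\<bar>b\<bar> + 1)" using neg by (simp add: t_def)
    ultimately show False by simp
  qed
  from psd_of_dual[OF this] have psd: "transpose S = S" "\<And>x. 0 \<le> x \<bullet> (S *v x)" by auto
  have "(S - A ** S ** transpose A) \<bullet> Z = 0" for Z
  proof -
    have "S \<bullet> (transpose A ** Z ** A) = (A ** S ** transpose A) \<bullet> Z"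
      using inner_matrix_mult_right[of S "transpose A ** Z" A]
        inner_matrix_mult_left[of "S ** transpose A" "transpose A" Z]
      by (simp add: matrix_mul_assoc)
    then show ?thesis
      using orth[of "Z - transpose A ** Z ** A"]
      by (simp add: L_def inner_diff_right inner_diff_left)
  qed
  then have "A ** S ** transpose A = S"
    by (metis inner_eq_zero_iff right_minus_eq)
  then show False using invariant_psd_form_eq_0[OF hyp inv psd] S by simp
qed

text \<open>Only the quadratic form of \<open>Z\<close> enters positive definiteness, so \<open>Z\<close> can be replaced by its
  symmetric part.\<close>

lemma symmetric_stein_inequality:
  fixes A Q :: "real ^ 'm ^ 'm"
  assumes hyp: "truly_hyperbolic A" and inv: "invertible A"
  obtains Z where "transpose Z = Z" "positive_definite (Q + (Z - transpose A ** Z ** A))"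
proof -
  obtain Z where Z: "positive_definite (Q + (Z - transpose A ** Z ** A))"
    using stein_inequality[OF assms] .
  define Y where "Y = (1/2) *\<^sub>R (Z + transpose Z)"
  have "transpose Y = Y" by (simp add: Y_def transpose_scalar transpose_add add.commute)
  moreover have form: "x \<bullet> (Y *v x) = x \<bullet> (Z *v x)" for x
    using dot_lmul_matrix[of x Z x]
    by (simp add: Y_def scaleR_matrix_vector_assoc[symmetric] matrix_vector_mult_add_rdistrib
        inner_add_right inner_commute)
  have pull: "x \<bullet> ((transpose A ** M ** A) *v x) = (A *v x) \<bullet> (M *v (A *v x))" for M x
    by (metis dot_lmul_matrix matrix_vector_mul_assoc transpose_matrix_vector transpose_transpose)
  have "positive_definite (Q + (Y - transpose A ** Y ** A))"
    using Z by (simp add: positive_definite_def matrix_vector_mult_add_rdistrib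
        matrix_vector_mult_diff_rdistrib inner_add_right inner_diff_right pull form)
  ultimately show thesis using that by blast
qed

section \<open>The standard symplectic form\<close>

lemma J_nth: "J $ (i, a) $ (j, b) = (if i = j then J2 $ a $ b else 0)"
  by (simp add: J_def)

lemma J2_nth [simp]: "J2 $ 1 $ 1 = 0" "J2 $ 1 $ 2 = -1" "J2 $ 2 $ 1 = 1" "J2 $ 2 $ 2 = 0"
  by (simp_all add: J2_def)

lemma transpose_J: "transpose J = - (J :: ('n::finite) sp_mat)"
proof -
  have skew: "J2 $ b $ a = - J2 $ a $ b" for a b :: 2
    using exhaust_2[of a] exhaust_2[of b] by auto
  have "transpose J $ p $ q = - (J :: 'n sp_mat) $ p $ q" for p q
    using skew[of "snd q" "snd p"] by (simp add: transpose_def J_def)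
  then show ?thesis by (simp add: vec_eq_iff)
qed

lemma J_mult_J: "J ** J = - (mat 1 :: ('n::finite) sp_mat)"
proof -
  have J2: "(\<Sum>b\<in>UNIV. J2 $ a $ b * J2 $ b $ c) = (if a = c then -1 else 0)" for a c :: 2
    using exhaust_2[of a] exhaust_2[of c] by (auto simp: sum_2)
  have "(J ** J) $ (i, a) $ (j, c) = (if i = j \<and> a = c then -1 else 0)" for i j :: 'n and a c
  proof -
    have "(J ** J) $ (i, a) $ (j, c)
        = (\<Sum>k\<in>UNIV. \<Sum>b\<in>UNIV. J $ (i, a) $ (k, b) * J $ (k, b) $ (j, c))"
      by (simp add: matrix_matrix_mult_def sum.cartesian_product)
    also have "\<dots> = (\<Sum>k\<in>UNIV. if k = i then if i = j then \<Sum>b\<in>UNIV. J2 $ a $ b * J2 $ b $ c else 0 else 0)"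
      by (intro sum.cong) (auto simp: J_nth)
    also have "\<dots> = (if i = j \<and> a = c then -1 else 0)" by (simp add: J2)
    finally show ?thesis .
  qed
  then show ?thesis by (auto simp: vec_eq_iff mat_def split_paired_all)
qed

lemma Sp_mult: "X \<in> Sp \<Longrightarrow> Y \<in> Sp \<Longrightarrow> X ** Y \<in> Sp"
  unfolding Sp_def by (simp add: invertible_mult matrix_transpose_mul) (metis matrix_mul_assoc)

text \<open>The defining equation, with \<open>J\<^sup>2 = - I\<close>, makes \<open>- J A\<^sup>T J\<close> a left inverse of \<open>A\<close>; it is then also a
  right inverse.\<close>

lemma Sp_transpose:
  assumes "A \<in> Sp"
  shows "A ** J ** transpose A = J"
proof -
  have "(- J ** transpose A ** J) ** A = mat 1"
    using assms by (simp add: Sp_def matrix_mul_assoc[symmetric] matrix_mult.minus_left J_mult_J)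
  then have "A ** (- J ** transpose A ** J) = mat 1" by (simp add: matrix_left_right_inverse)
  then have "A ** (- J ** transpose A ** J) ** (- J) = - J" by simp
  then show ?thesis
    by (simp add: matrix_mul_assoc[symmetric] matrix_mult.minus_left matrix_mult.minus_right J_mult_J)
qed

section \<open>Symplectic curves through the identity\<close>

text \<open>The curve \<open>Y\<close> of inverses is part of the data, so that conjugating along \<open>X\<close> gives a \<open>C\<^sup>1\<close> curve
  by the product rule alone, without differentiating matrix inversion.\<close>

definition symplectic_velocity :: "('n::finite) sp_mat \<Rightarrow> bool" where
  "symplectic_velocity K \<longleftrightarrow> (\<exists>X Y.
     X C1_differentiable_on UNIV \<and> Y C1_differentiable_on UNIV \<and>
     (\<forall>t. X t \<in> Sp \<and> X t ** Y t = mat 1) \<and> X 0 = mat 1 \<and>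
     (X has_vector_derivative K) (at 0) \<and> (Y has_vector_derivative - K) (at 0))"

lemma symplectic_velocity_0: "symplectic_velocity 0"
  unfolding symplectic_velocity_def
  by (rule exI[of _ "\<lambda>_. mat 1"], rule exI[of _ "\<lambda>_. mat 1"]) (auto simp: Sp_def invertible_def)

lemma symplectic_velocity_add:
  assumes "symplectic_velocity K" "symplectic_velocity L"
  shows "symplectic_velocity (K + L)"
proof -
  obtain X Y where X: "X C1_differentiable_on UNIV" "Y C1_differentiable_on UNIV"
     "\<And>t. X t \<in> Sp" "\<And>t. X t ** Y t = mat 1" "X 0 = mat 1"
     "(X has_vector_derivative K) (at 0)" "(Y has_vector_derivative - K) (at 0)"
    using assms(1) unfolding symplectic_velocity_def by blast
  obtain U V where U: "U C1_differentiable_on UNIV" "V C1_differentiable_on UNIV"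
     "\<And>t. U t \<in> Sp" "\<And>t. U t ** V t = mat 1" "U 0 = mat 1"
     "(U has_vector_derivative L) (at 0)" "(V has_vector_derivative - L) (at 0)"
    using assms(2) unfolding symplectic_velocity_def by blast
  have 0: "Y 0 = mat 1" "V 0 = mat 1" using X(4)[of 0] U(4)[of 0] X(5) U(5) by auto
  have "X t ** U t ** (V t ** Y t) = mat 1" for t
    by (metis X(4) U(4) matrix_mul_assoc matrix_mul_rid)
  moreover have "((\<lambda>t. X t ** U t) has_vector_derivative (K + L)) (at 0)"
    using matrix_mult.has_vector_derivative[OF X(6) U(6)] by (simp add: X(5) U(5) add.commute)
  moreover have "((\<lambda>t. V t ** Y t) has_vector_derivative - (K + L)) (at 0)"
    using matrix_mult.has_vector_derivative[OF U(7) X(7)] by (simp add: 0)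
  moreover have "(\<lambda>t. X t ** U t) C1_differentiable_on UNIV" "(\<lambda>t. V t ** Y t) C1_differentiable_on UNIV"
    using X U by (auto intro: C1_differentiable_on_matrix_mult)
  moreover have "X t ** U t \<in> Sp" for t using X(3) U(3) by (rule Sp_mult)
  moreover have "X 0 ** U 0 = mat 1" by (simp add: X(5) U(5))
  ultimately show ?thesis unfolding symplectic_velocity_def by blast
qed

lemma symplectic_velocity_sum:
  "(\<And>i. i \<in> I \<Longrightarrow> symplectic_velocity (f i)) \<Longrightarrow> symplectic_velocity (\<Sum>i\<in>I. f i)"
  by (induction I rule: infinite_finite_induct)
    (auto intro: symplectic_velocity_0 symplectic_velocity_add)

text \<open>When \<open>P J P = 0\<close>, the matrix \<open>J P\<close> squares to zero, so the exponential of
  \<open>t J P\<close> is the polynomial \<open>I + t J P\<close>, with inverse \<open>I - t J P\<close>.\<close>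

lemma symplectic_velocity_isotropic:
  assumes sym: "transpose P = P" and iso: "P ** J ** P = 0"
  shows "symplectic_velocity (J ** P)"
proof -
  define X where "X t = mat 1 + t *\<^sub>R (J ** P)" for t
  have KK: "J ** P ** (J ** P) = 0"
    by (metis iso matrix_mul_assoc times0_right)
  have mult: "X s ** X t = mat 1 + (s + t) *\<^sub>R (J ** P)" for s t
    by (simp add: X_def matrix_mult.add_right matrix_mult.add_left matrix_mult.scaleR_right
        matrix_mult.scaleR_left KK algebra_simps)
  have inv: "X t ** X (- t) = mat 1" for t by (simp add: mult)
  have "transpose (X t) = mat 1 - t *\<^sub>R (P ** J)" for t
    by (simp add: X_def transpose_add transpose_scalar matrix_transpose_mul transpose_J sym
        matrix_mult.minus_right)
  moreover have "(mat 1 - t *\<^sub>R (P ** J)) ** J ** (mat 1 + t *\<^sub>R (J ** P)) = J" for t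
  proof -
    have PJJ: "P ** J ** J = - P"
      by (simp add: matrix_mul_assoc[symmetric] J_mult_J matrix_mult.minus_right)
    have JJP: "J ** (J ** P) = - P"
      by (simp add: matrix_mul_assoc J_mult_J matrix_mult.minus_left)
    have "(mat 1 - t *\<^sub>R (P ** J)) ** J = J + t *\<^sub>R P"
      using PJJ by (simp add: matrix_mult.diff_left matrix_mult.scaleR_left)
    moreover have "(J + t *\<^sub>R P) ** (mat 1 + t *\<^sub>R (J ** P)) = J"
      by (simp add: matrix_mult.add_right matrix_mult.add_left matrix_mult.scaleR_right
        matrix_mult.scaleR_left JJP matrix_mul_assoc[of P] iso)
    ultimately show ?thesis by simp
  qed
  ultimately have "X t \<in> Sp" for t
    unfolding Sp_def mem_Collect_eq invertible_right_inverse
    using inv[of t] by (intro conjI exI[of _ "X (- t)"]) (simp_all add: X_def)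
  moreover have deriv: "(X has_vector_derivative J ** P) (at t)" for t
    unfolding X_def by (auto intro!: derivative_eq_intros)
  moreover have deriv': "((\<lambda>t. X (- t)) has_vector_derivative - (J ** P)) (at t)" for t
    unfolding X_def by (auto intro!: derivative_eq_intros)
  moreover have "X C1_differentiable_on UNIV" "(\<lambda>t. X (- t)) C1_differentiable_on UNIV"
    unfolding C1_differentiable_on_def
    by (rule exI[of _ "\<lambda>_. J ** P"], use deriv in simp)
      (rule exI[of _ "\<lambda>_. - (J ** P)"], use deriv' in simp)
  moreover have "X 0 = mat 1" by (simp add: X_def)
  ultimately show ?thesis
    unfolding symplectic_velocity_def using inv
    by (intro exI[of _ X] exI[of _ "\<lambda>t. X (- t)"]) simp
qed

text \<open>The rank-one case, a symplectic transvection: every single vector \<open>y\<close> is isotropic because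
  \<open>J\<close> is skew.\<close>

lemma symplectic_velocity_transvection: "symplectic_velocity (J ** (c *\<^sub>R outer_prod y y))"
proof (rule symplectic_velocity_isotropic)
  show "transpose (c *\<^sub>R outer_prod y y) = c *\<^sub>R outer_prod y y"
    by (simp add: transpose_scalar) (simp add: outer_prod_def transpose_def vec_eq_iff mult.commute)
  have "y \<bullet> (J *v y) = (transpose J *v y) \<bullet> y"
    by (simp add: dot_lmul_matrix)
  also have "\<dots> = - (y \<bullet> (J *v y))"
    using matrix_vector_mult_diff_rdistrib[of 0 J y]
    by (simp add: transpose_J inner_commute del: transpose_matrix_vector)
  finally have "y \<bullet> (J *v y) = 0" by simp
  then have "(outer_prod y y ** J ** outer_prod y y) *v x = 0" for x
    by (simp add: matrix_vector_mul_assoc[symmetric] outer_prod_mult_vec matrix_vector_mult_scaleR)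
  then have "outer_prod y y ** J ** outer_prod y y = 0" by (simp add: matrix_eq)
  then show "c *\<^sub>R outer_prod y y ** J ** (c *\<^sub>R outer_prod y y) = 0"
    by (simp add: matrix_mult.scaleR_right matrix_mult.scaleR_left)
qed

text \<open>By polarization, \<open>x y\<^sup>T + y x\<^sup>T = (x + y)(x + y)\<^sup>T - x x\<^sup>T - y y\<^sup>T\<close>, so every symmetric matrix
  is a sum of multiples of squares \<open>y y\<^sup>T\<close>. The curve obtained is a product of transvections, which
  serves in place of the matrix exponential of \<open>t J Y\<close>.\<close>

lemma symplectic_velocity_symmetric:
  fixes Y :: "('n::finite) sp_mat"
  assumes sym: "transpose Y = Y"
  shows "symplectic_velocity (J ** Y)"
proof -
  let ?e = "\<lambda>i. axis i (1::real)"
  let ?P = "\<lambda>c y. J ** (c *\<^sub>R outer_prod y y) :: 'n sp_mat"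
  have Ysym: "Y $ a $ b = Y $ b $ a" for a b
    using sym by (metis (no_types, lifting) transpose_def vec_lambda_beta)
  have "Y = (\<Sum>i\<in>UNIV. \<Sum>j\<in>UNIV. (Y $ i $ j / 2) *\<^sub>R outer_prod (?e i + ?e j) (?e i + ?e j)
      + (- (Y $ i $ j / 2)) *\<^sub>R outer_prod (?e i) (?e i)
      + (- (Y $ i $ j / 2)) *\<^sub>R outer_prod (?e j) (?e j))" (is "_ = ?S")
  proof -
    have "?S $ a $ b = Y $ a $ b" for a b
    proof -
      have "?S $ a $ b = (\<Sum>i\<in>UNIV. \<Sum>j\<in>UNIV. 
         (if i = a then if j = b then Y $ i $ j / 2 else 0 else 0)
         + (if i = b then if j = a then Y $ i $ j / 2 else 0 else 0))"
        unfolding sum_component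
        by (intro sum.cong refl) (auto simp: outer_prod_def axis_def)
      also have "\<dots> = (\<Sum>i\<in>UNIV. (if i = a then Y $ i $ b / 2 else 0) + (if i = b then Y $ i $ a / 2 else 0))"
        unfolding sum.distrib by (intro arg_cong2[of _ _ _ _ "(+)"] sum.cong refl) auto
      also have "\<dots> = Y $ a $ b" using Ysym[of a b] by (simp add: sum.distrib)
      finally show ?thesis .
    qed
    then show ?thesis by (simp add: vec_eq_iff)
  qed
  then have "J ** Y = J ** ?S" by simp
  also have "\<dots> = (\<Sum>i\<in>UNIV. \<Sum>j\<in>UNIV. ?P (Y $ i $ j / 2) (?e i + ?e j)
      + ?P (- (Y $ i $ j / 2)) (?e i) + ?P (- (Y $ i $ j / 2)) (?e j))"
    by (simp only: matrix_mult.sum_right matrix_mult.add_right)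
  finally show ?thesis
    by (simp only:) (intro symplectic_velocity_sum symplectic_velocity_add symplectic_velocity_transvection)
qed

section \<open>Surjectivity onto the tangent space of the conjugacy classes\<close>

lemma commutator_tangent_conj_class:
  fixes A :: "('n::finite) sp_mat"
  assumes "symplectic_velocity K"
  shows "K ** A - A ** K \<in> tangent_vectors (conj_class A) A"
proof -
  obtain X Y where X: "X C1_differentiable_on UNIV" "Y C1_differentiable_on UNIV"
     "\<And>t. X t \<in> Sp" "\<And>t. X t ** Y t = mat 1" "X 0 = mat 1"
     "(X has_vector_derivative K) (at 0)" "(Y has_vector_derivative - K) (at 0)"
    using assms(1) unfolding symplectic_velocity_def by blast
  have Y0: "Y 0 = mat 1" using X(4)[of 0] X(5) by simp
  define c where "c t = X t ** A ** Y t" for t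
  have "c t \<in> conj_class A" for t
    unfolding conj_class_def c_def mem_Collect_eq
    using X(3)[of t] matrix_inv_eqI[OF X(4)[of t]] by (intro exI[of _ "X t"]) simp
  moreover have "c C1_differentiable_on {-1<..<1}"
    unfolding c_def
    by (intro C1_differentiable_on_matrix_mult C1_differentiable_on_const)
      (use X C1_differentiable_on_subset in blast)+
  moreover have "(c has_vector_derivative (K ** A - A ** K)) (at 0)"
    unfolding c_def using matrix_mult.has_vector_derivative[OF matrix_mult.has_vector_derivative[OF X(6)
        has_vector_derivative_const[of A]] X(7)]
    by (simp add: X(5) Y0 matrix_mult.minus_right)
  moreover have "c 0 = A" by (simp add: c_def X(5) Y0)
  ultimately show ?thesis
    unfolding tangent_vectors_def by (intro CollectI exI[of _ c] exI[of _ 1]) auto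
qed

theorem propositionD:
  fixes A :: "('n::finite) sp_mat"
  assumes "A \<in> Sp"
    and "truly_hyperbolic A"
  shows "maps_onto_tangent_Conj (positive_cone A) A"
  unfolding maps_onto_tangent_Conj_def
proof (intro conjI ballI)
  show "positive_cone A \<subseteq> tangent_Sp A"
    unfolding positive_cone_def tangent_Sp_def
    by (intro Collect_mono impI) (elim exE conjE, intro exI conjI)
next
  fix V assume "V \<in> tangent_Sp A"
  then obtain Q where Q: "V = J ** Q ** A" "transpose Q = Q"
    unfolding tangent_Sp_def by (elim CollectE exE conjE)
  have "invertible A" using assms(1) by (simp add: Sp_def)
  then obtain Z where Z: "transpose Z = Z" "positive_definite (Q + (Z - transpose A ** Z ** A))"
    by (rule symmetric_stein_inequality[OF assms(2)])
  define Y where "Y = - (transpose A ** Z ** A)"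
  have tr: "transpose (- M) = - transpose M" for M :: "'n sp_mat"
    by (simp add: transpose_def vec_eq_iff)
  have Y: "transpose Y = Y"
    by (simp add: Y_def tr matrix_transpose_mul Z(1) matrix_mul_assoc)
  have P: "Q + (Z - transpose A ** Z ** A) = Q + (Z + Y)" by (simp add: Y_def)
  define W where "W = J ** (Q + (Z + Y)) ** A"
  have "W \<in> positive_cone A"
    unfolding positive_cone_def W_def mem_Collect_eq
    using Z Q(2) Y by (intro exI[of _ "Q + (Z + Y)"]) (simp add: P transpose_add)
  \<comment> \<open>By \<open>A J A\<^sup>T = J\<close>, the vector \<open>J (Z + Y) A\<close> is the commutator of \<open>J Y\<close> and \<open>A\<close>.\<close>
  moreover have "A ** (J ** Y) = - (J ** Z ** A)"
    using Sp_transpose[OF assms(1)] by (simp add: Y_def matrix_mult.minus_right matrix_mul_assoc)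
  then have "W - V = (J ** Y) ** A - A ** (J ** Y)"
    by (simp add: W_def Q(1) matrix_mult.add_right matrix_mult.add_left)
  then have "W - V \<in> tangent_vectors (conj_class A) A"
    using commutator_tangent_conj_class[OF symplectic_velocity_symmetric[OF Y]] by simp
  ultimately show "\<exists>W\<in>positive_cone A. W - V \<in> tangent_vectors (conj_class A) A" by blast
qed

end
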